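(* Let $\mathbb{F}$ be a field with $|\mathbb{F}|\geqslant 3$. Let $I,J$ be disjoint finite sets, and let $T$ be a symmetrized tropical matrix with row index set $I^1\cup I^2$ and column index set $I\cup J$. Then $$\operatorname{Kapranov\ rank}(T)=\operatorname{Kapranov\ rank}(\Sigma(T))+|I|,$$ with Kapranov ranks taken over $\mathbb{F}$.
   Context: Supertropical structure: $\mathbb{S}=\mathbb{R}^{\tau}\cup\mathbb{R}^{\gamma}\cup\{\infty\}$ with tangible elements $a^\tau$ and ghost elements $a^\gamma$ ($a\in\mathbb{R}$); for $a>b$: $\infty\oplus s=s$, $\infty\odot s=\infty$, $b^j\oplus a^i=b^j$, $b^i\oplus b^j=b^\gamma$, $a^i\odot b^j=(a+b)^\alpha$ with $\alpha=\tau$ iff $i=j=\tau$. A tropical matrix (entries in $\overline{\mathbb{R}}=\mathbb{R}\cup\{\infty\}$) is regarded as a supertropical matrix by replacing each real $a$ by $a^\tau$. $I^1,I^2$ are two disjoint copies of $I$ (also disjoint from $I\cup J$), with $i^1,i^2$ the copies of $i\in I$. A tropical matrix $T$ with rows $I^1\cup I^2$ and columns $I\cup J$ is symmetrized if $T(i^1|i)=T(i^2|i)=0$ and $T(i^1|\hat\iota)=T(i^2|\hat\iota)=\infty$ for all $i\in I$, $\hat\iota\in I\setminus\{i\}$. Then $\Sigma(T)\in\mathbb{S}^{I\times J}$ is defined by $\Sigma(T)(i|j)=T(i^1|j)^\tau\oplus T(i^2|j)^\tau$ (supertropical sum, with $\infty^\tau$ meaning $\infty$). Kapranov rank over $\mathbb{F}$: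 let $\mathcal{F}=\mathbb{F}\{\{t\}\}$ be the field of generalized Puiseux series $\sum_{e\in\mathbb{R}}a_et^e$ ($a_e\in\mathbb{F}$, well-ordered support), with $\deg a=\min\operatorname{Supp}(a)$, $\deg 0=\infty$. For supertropical $c$ and $d\in\overline{\mathbb{R}}$ (viewed as $d^\tau$, or $\infty$), write $c\models d$ if $c=d$ or $c=d\oplus g$ for some ghost $g$. The Kapranov rank of a supertropical matrix $A$ is the smallest rank of a matrix $L$ over $\mathcal{F}$ with $A(p|q)\models\deg L(p|q)$ for all entries (equivalently: if $A(p|q)=a^\tau$ then $\deg L(p|q)=a$; if $A(p|q)=a^\gamma$ then $\deg L(p|q)\geqslant a$; if $A(p|q)=\infty$ then $L(p|q)=0$). *)

theory Defs
  imports Complex_Main "HOL-Library.Function_Algebras"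
begin

section \<open>Well-ordered sets of reals\<close>

definition wo_set :: "real set \<Rightarrow> bool"
  where "wo_set A \<longleftrightarrow> (\<forall>S. S \<subseteq> A \<longrightarrow> S \<noteq> {} \<longrightarrow> (\<exists>m\<in>S. \<forall>x\<in>S. m \<le> x))"

lemma wo_setD:
  assumes "wo_set A" "S \<subseteq> A" "S \<noteq> {}"
  obtains m where "m \<in> S" "\<And>x. x \<in> S \<Longrightarrow> m \<le> x"
proof -
  have "\<exists>m\<in>S. \<forall>x\<in>S. m \<le> x" using assms by (simp add: wo_set_def)
  then show ?thesis using that by blast
qed

lemma wo_set_mono: "wo_set A \<Longrightarrow> B \<subseteq> A \<Longrightarrow> wo_set B"
  unfolding wo_set_def by (meson subset_trans)

lemma wo_set_empty [simp]: "wo_set {}"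
  unfolding wo_set_def by blast

lemma wo_set_singleton [simp]: "wo_set {a}"
  unfolding wo_set_def by (auto dest: subset_singletonD)

lemma wo_set_Un:
  assumes "wo_set A" "wo_set B"
  shows "wo_set (A \<union> B)"
  unfolding wo_set_def
proof (intro allI impI)
  fix S assume S: "S \<subseteq> A \<union> B" "S \<noteq> {}"
  show "\<exists>m\<in>S. \<forall>x\<in>S. m \<le> x"
  proof (cases "S \<inter> A = {} \<or> S \<inter> B = {}")
    case True
    then have "S \<subseteq> B \<or> S \<subseteq> A" using S by blast
    then show ?thesis using assms S(2) by (auto simp: wo_set_def)
  next
    case False
    obtain a where a: "a \<in> S \<inter> A" "\<And>x. x \<in> S \<inter> A \<Longrightarrow> a \<le> x"
      using wo_setD[OF assms(1), of "S \<inter> A"] False by blast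
    obtain b where b: "b \<in> S \<inter> B" "\<And>x. x \<in> S \<inter> B \<Longrightarrow> b \<le> x"
      using wo_setD[OF assms(2), of "S \<inter> B"] False by blast
    have "min a b \<in> S" using a b by (simp add: min_def)
    moreover have "min a b \<le> x" if "x \<in> S" for x
      using a(2)[of x] b(2)[of x] that S(1) by (auto simp: min_le_iff_disj)
    ultimately show ?thesis by blast
  qed
qed

lemma wo_set_UN:
  assumes "finite N" "\<And>n. n \<in> N \<Longrightarrow> wo_set (A n)"
  shows "wo_set (\<Union>n\<in>N. A n)"
  using assms by (induction N rule: finite_induct) (auto intro: wo_set_Un)

lemma wo_set_local:
  assumes "\<And>s. s \<in> A \<Longrightarrow> wo_set {x\<in>A. x \<le> s}"
  shows "wo_set A"
  unfolding wo_set_def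
proof (intro allI impI)
  fix S assume S: "S \<subseteq> A" "S \<noteq> {}"
  then obtain s where s: "s \<in> S" by blast
  obtain m where m: "m \<in> {x\<in>S. x \<le> s}" "\<And>x. x \<in> {x\<in>S. x \<le> s} \<Longrightarrow> m \<le> x"
    using wo_setD[OF assms[of s], of "{x\<in>S. x \<le> s}"] s S by blast
  then have "m \<le> x" if "x \<in> S" for x
    using that by (cases "x \<le> s") (auto intro: order.trans)
  with m show "\<exists>m\<in>S. \<forall>x\<in>S. m \<le> x" by blast
qed

lemma wo_set_no_decreasing:
  assumes "wo_set A" "\<And>n::nat. s n \<in> A" "\<And>n. s (Suc n) < s n"
  shows False
proof -
  obtain m where m: "m \<in> range s" "\<And>x. x \<in> range s \<Longrightarrow> m \<le> x"
    using wo_setD[OF assms(1), of "range s"] assms(2) by blast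
  then obtain n where "m = s n" by blast
  with m(2)[of "s (Suc n)"] assms(3)[of n] show False by simp
qed

lemma wo_set_sum:
  assumes A: "wo_set A" and B: "wo_set B"
  shows "wo_set {a + b | a b. a \<in> A \<and> b \<in> B}"
  unfolding wo_set_def
proof (intro allI impI, rule ccontr)
  fix S assume S: "S \<subseteq> {a + b | a b. a \<in> A \<and> b \<in> B}" "S \<noteq> {}"
    and "\<not> (\<exists>m\<in>S. \<forall>x\<in>S. m \<le> x)"
  then have *: "\<exists>y. y \<in> S \<and> y < x" if "x \<in> S" for x
    using that by (meson not_le)
  obtain s0 where "s0 \<in> S" using S by blast
  obtain s where s: "\<And>n. s n \<in> S" "\<And>n. s (Suc n) < s n"
    using dependent_nat_choice[where P = "\<lambda>_::nat. \<lambda>x. x \<in> S" and Q = "\<lambda>_::nat. \<lambda>x y. y < x"]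
      \<open>s0 \<in> S\<close> * by blast
  have "\<forall>n. \<exists>a b. a \<in> A \<and> b \<in> B \<and> s n = a + b" using s(1) S by blast
  then obtain a b where ab: "\<And>n. a n \<in> A" "\<And>n. b n \<in> B" "\<And>n. s n = a n + b n"
    by metis
  have s_less: "s n < s m" if "m < n" for m n
    using lift_Suc_mono_less[of "\<lambda>n. - s n" m n] s(2) that by simp
  obtain g :: "nat \<Rightarrow> nat" where g: "strict_mono g" "monoseq (\<lambda>n. a (g n))"
    using seq_monosub by blast
  have "\<exists>N. \<forall>n\<ge>N. a (g n) \<le> a (g (Suc n))"
  proof (cases "incseq (\<lambda>n. a (g n))")
    case True
    then show ?thesis by (auto simp: incseq_Suc_iff)
  next
    case False
    then have dec: "decseq (\<lambda>n. a (g n))"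
      using g(2) by (simp add: monoseq_iff)
    obtain m where m: "m \<in> range (\<lambda>n. a (g n))" "\<And>x. x \<in> range (\<lambda>n. a (g n)) \<Longrightarrow> m \<le> x"
      using wo_setD[OF A, of "range (\<lambda>n. a (g n))"] ab(1) by blast
    then obtain N where N: "m = a (g N)" by blast
    have "a (g n) \<le> a (g (Suc n))" if "n \<ge> N" for n
    proof -
      have "a (g n) \<le> a (g N)" using dec that by (simp add: decseq_def)
      also have "\<dots> \<le> a (g (Suc n))" using m(2) N by blast
      finally show ?thesis .
    qed
    then show ?thesis by blast
  qed
  then obtain N where N: "\<And>n. n \<ge> N \<Longrightarrow> a (g n) \<le> a (g (Suc n))" by blast
  show False
  proof (rule wo_set_no_decreasing[OF B, of "\<lambda>n. b (g (n + N))"])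
    show "b (g (n + N)) \<in> B" for n using ab(2) .
    show "b (g (Suc n + N)) < b (g (n + N))" for n
      using s_less[of "g (n + N)" "g (Suc n + N)"] N[of "n + N"] g(1)
      by (simp add: ab(3) strict_mono_def)
  qed
qed

lemma finite_wo_set:
  assumes "wo_set A" "wo_set (uminus ` A)"
  shows "finite A"
proof (rule ccontr)
  assume inf: "infinite A"
  have mx: "\<exists>m\<in>S. \<forall>x\<in>S. x \<le> m" if "S \<subseteq> A" "S \<noteq> {}" for S
  proof -
    have "uminus ` S \<subseteq> uminus ` A" "uminus ` S \<noteq> {}" using that by auto
    then obtain m where m: "m \<in> uminus ` S" "\<And>x. x \<in> uminus ` S \<Longrightarrow> m \<le> x"
      using wo_setD[OF assms(2)] by metis
    then obtain k where "k \<in> S" "m = - k" by blast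
    then show ?thesis using m(2) by (metis imageI neg_le_iff_le)
  qed
  define D where "D = {x\<in>A. infinite {y\<in>A. y \<le> x}}"
  have "A \<noteq> {}" using inf by auto
  then obtain M where M: "M \<in> A" "\<forall>x\<in>A. x \<le> M" using mx[of A] by blast
  then have "{y\<in>A. y \<le> M} = A" by blast
  then have "M \<in> D" using inf M by (simp add: D_def)
  then obtain m where m: "m \<in> D" "\<And>x. x \<in> D \<Longrightarrow> m \<le> x"
    using wo_setD[OF assms(1), of D] unfolding D_def by blast
  let ?L = "{y\<in>A. y < m}"
  have "{y\<in>A. y \<le> m} \<subseteq> insert m ?L" by auto
  moreover have "infinite {y\<in>A. y \<le> m}" using m(1) by (simp add: D_def)
  ultimately have infL: "infinite ?L" by (meson finite_insert finite_subset)
  then have "?L \<noteq> {}" using finite.emptyI by fastforce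
  then obtain k where k: "k \<in> ?L" "\<forall>x\<in>?L. x \<le> k" using mx[of ?L] by blast
  then have "?L \<subseteq> {y\<in>A. y \<le> k}" by blast
  then have "infinite {y\<in>A. y \<le> k}" using infL finite_subset by blast
  then have "k \<in> D" using k(1) by (simp add: D_def)
  then have "m \<le> k" by (rule m(2))
  then show False using k(1) by simp
qed

lemma finite_decomp:
  assumes "wo_set A" "wo_set B"
  shows "finite {x\<in>A. e - x \<in> B}"
proof (rule finite_wo_set)
  show "wo_set {x\<in>A. e - x \<in> B}" using assms(1) by (rule wo_set_mono) blast
  have "uminus ` {x\<in>A. e - x \<in> B} \<subseteq> {a + b | a b. a \<in> {-e} \<and> b \<in> B}"
  proof
    fix y assume "y \<in> uminus ` {x\<in>A. e - x \<in> B}"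
    then obtain x where "e - x \<in> B" "y = - x" by blast
    then show "y \<in> {a + b | a b. a \<in> {-e} \<and> b \<in> B}"
      by (intro CollectI exI[of _ "-e"] exI[of _ "e - x"]) simp
  qed
  then show "wo_set (uminus ` {x\<in>A. e - x \<in> B})"
    by (rule wo_set_mono[OF wo_set_sum[OF wo_set_singleton assms(2)]])
qed

section \<open>The field of generalized Puiseux series\<close>

typedef (overloaded) 'k gen_puiseux = "{f :: real \<Rightarrow> 'k::zero. wo_set {e. f e \<noteq> 0}}"
  morphisms coeff Abs_gen_puiseux
  by (rule exI[of _ "\<lambda>_. 0"]) simp

setup_lifting type_definition_gen_puiseux

definition supp :: "'k::zero gen_puiseux \<Rightarrow> real set"
  where "supp a = {e. coeff a e \<noteq> 0}"

lemma wo_set_supp [simp]: "wo_set (supp a)"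
  unfolding supp_def using coeff[of a] by simp

lemma gen_puiseux_eqI: "(\<And>e. coeff a e = coeff b e) \<Longrightarrow> a = b"
  by (simp add: coeff_inject[symmetric] fun_eq_iff)

instantiation gen_puiseux :: (zero) zero
begin
lift_definition zero_gen_puiseux :: "'a gen_puiseux" is "\<lambda>_. 0" by simp
instance ..
end

instantiation gen_puiseux :: (comm_ring_1) comm_ring_1
begin

lift_definition one_gen_puiseux :: "'a gen_puiseux" is "\<lambda>e. if e = 0 then 1 else 0"
  by simp

lift_definition plus_gen_puiseux :: "'a gen_puiseux \<Rightarrow> 'a gen_puiseux \<Rightarrow> 'a gen_puiseux"
  is "\<lambda>f g e. f e + g e"
  subgoal for f g by (rule wo_set_mono[OF wo_set_Un[of "{e. f e \<noteq> 0}" "{e. g e \<noteq> 0}"]]) auto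
  done

lift_definition uminus_gen_puiseux :: "'a gen_puiseux \<Rightarrow> 'a gen_puiseux"
  is "\<lambda>f e. - f e" by simp

lift_definition minus_gen_puiseux :: "'a gen_puiseux \<Rightarrow> 'a gen_puiseux \<Rightarrow> 'a gen_puiseux"
  is "\<lambda>f g e. f e - g e"
  subgoal for f g by (rule wo_set_mono[OF wo_set_Un[of "{e. f e \<noteq> 0}" "{e. g e \<noteq> 0}"]]) auto
  done

lift_definition times_gen_puiseux :: "'a gen_puiseux \<Rightarrow> 'a gen_puiseux \<Rightarrow> 'a gen_puiseux"
  is "\<lambda>f g e. \<Sum>x | f x \<noteq> 0 \<and> g (e - x) \<noteq> 0. f x * g (e - x)"
  subgoal for f g
  proof (rule wo_set_mono[OF wo_set_sum[of "{e. f e \<noteq> 0}" "{e. g e \<noteq> 0}"]], simp, simp, rule subsetI)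
    fix e assume "e \<in> {e. (\<Sum>x | f x \<noteq> 0 \<and> g (e - x) \<noteq> 0. f x * g (e - x)) \<noteq> 0}"
    then obtain x where "f x \<noteq> 0" "g (e - x) \<noteq> 0"
      by (auto elim: sum.not_neutral_contains_not_neutral)
    then show "e \<in> {a + b |a b. a \<in> {e. f e \<noteq> 0} \<and> b \<in> {e. g e \<noteq> 0}}"
      by (intro CollectI exI[of _ x] exI[of _ "e - x"]) simp
  qed
  done

lemma coeff_times:
  assumes "wo_set A" "wo_set B" "supp f \<subseteq> A" "supp g \<subseteq> B"
  shows "coeff (f * g) e = (\<Sum>x | x \<in> A \<and> e - x \<in> B. coeff f x * coeff g (e - x))"
  unfolding times_gen_puiseux.rep_eq
proof (rule sum.mono_neutral_left)
  show "finite {x. x \<in> A \<and> e - x \<in> B}" using finite_decomp[OF assms(1,2), of e] by simp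
  show "{x. coeff f x \<noteq> 0 \<and> coeff g (e - x) \<noteq> 0} \<subseteq> {x. x \<in> A \<and> e - x \<in> B}"
    using assms(3,4) by (auto simp: supp_def)
qed auto

lemma supp_times: "supp (f * g) \<subseteq> {a + b | a b. a \<in> supp f \<and> b \<in> supp g}"
proof
  fix e assume "e \<in> supp (f * g)"
  then have "(\<Sum>x | x \<in> supp f \<and> e - x \<in> supp g. coeff f x * coeff g (e - x)) \<noteq> 0"
    using coeff_times[of "supp f" "supp g" f g e] by (simp add: supp_def[of "f * g"])
  then obtain x where "x \<in> supp f" "e - x \<in> supp g"
    by (auto elim: sum.not_neutral_contains_not_neutral)
  then show "e \<in> {a + b | a b. a \<in> supp f \<and> b \<in> supp g}"
    by (intro CollectI exI[of _ x] exI[of _ "e - x"]) simp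
qed

instance
proof
  fix a b c :: "'a gen_puiseux"
  show "a + b + c = a + (b + c)" by transfer (simp add: add.assoc)
  show "a + b = b + a" by transfer (simp add: add.commute)
  show "0 + a = a" by transfer simp
  show "- a + a = 0" by transfer simp
  show "a - b = a + - b" by transfer simp
  show "(0::'a gen_puiseux) \<noteq> 1" by transfer (metis zero_neq_one)
  show comm: "a * b = b * a"
  proof (rule gen_puiseux_eqI)
    fix e
    show "coeff (a * b) e = coeff (b * a) e"
      unfolding times_gen_puiseux.rep_eq
      by (rule sum.reindex_bij_witness[of _ "\<lambda>x. e - x" "\<lambda>x. e - x"]) (auto simp: mult.commute)
  qed
  show "1 * a = a"
  proof (rule gen_puiseux_eqI)
    fix e
    have "supp (1 :: 'a gen_puiseux) \<subseteq> {0}" by (auto simp: supp_def one_gen_puiseux.rep_eq)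
    then have "coeff (1 * a) e = (\<Sum>x | x \<in> {0} \<and> e - x \<in> supp a. coeff 1 x * coeff a (e - x))"
      by (intro coeff_times) auto
    also have "\<dots> = (\<Sum>x\<in>{0}. coeff 1 x * coeff a (e - x))"
      by (rule sum.mono_neutral_left) (auto simp: supp_def)
    finally show "coeff (1 * a) e = coeff a e" by (simp add: one_gen_puiseux.rep_eq)
  qed
  show "(a + b) * c = a * c + b * c"
  proof (rule gen_puiseux_eqI)
    fix e
    let ?A = "supp a \<union> supp b"
    have A: "wo_set ?A" by (simp add: wo_set_Un)
    have "supp (a + b) \<subseteq> ?A" by (auto simp: supp_def plus_gen_puiseux.rep_eq)
    then have "coeff ((a + b) * c) e
        = (\<Sum>x | x \<in> ?A \<and> e - x \<in> supp c. coeff (a + b) x * coeff c (e - x))"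
      using A by (intro coeff_times) auto
    also have "\<dots> = (\<Sum>x | x \<in> ?A \<and> e - x \<in> supp c. coeff a x * coeff c (e - x))
                  + (\<Sum>x | x \<in> ?A \<and> e - x \<in> supp c. coeff b x * coeff c (e - x))"
      by (simp add: plus_gen_puiseux.rep_eq distrib_right sum.distrib)
    also have "(\<Sum>x | x \<in> ?A \<and> e - x \<in> supp c. coeff a x * coeff c (e - x)) = coeff (a * c) e"
      using A by (intro coeff_times[symmetric]) auto
    also have "(\<Sum>x | x \<in> ?A \<and> e - x \<in> supp c. coeff b x * coeff c (e - x)) = coeff (b * c) e"
      using A by (intro coeff_times[symmetric]) auto
    finally show "coeff ((a + b) * c) e = coeff (a * c + b * c) e"
      by (simp add: plus_gen_puiseux.rep_eq)
  qed
  show "a * b * c = a * (b * c)"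
  proof (rule gen_puiseux_eqI)
    fix e
    let ?AB = "{x + y | x y. x \<in> supp a \<and> y \<in> supp b}"
    let ?BC = "{x + y | x y. x \<in> supp b \<and> y \<in> supp c}"
    have AB: "wo_set ?AB" and BC: "wo_set ?BC" by (simp_all add: wo_set_sum)
    let ?t = "\<lambda>x y. coeff a x * coeff b y * coeff c (e - x - y)"
    have fin1: "finite {x. x \<in> ?AB \<and> e - x \<in> supp c}"
      using finite_decomp[OF AB, of "supp c" e] by simp
    have fin2: "finite {x. x \<in> supp a \<and> e - x \<in> ?BC}"
      using finite_decomp[OF _ BC, of "supp a" e] by simp
    have finab: "finite {x. x \<in> supp a \<and> z - x \<in> supp b}" for z
      using finite_decomp[of "supp a" "supp b" z] by simp
    have finbc: "finite {x. x \<in> supp b \<and> z - x \<in> supp c}" for z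
      using finite_decomp[of "supp b" "supp c" z] by simp
    have "coeff (a * b * c) e
        = (\<Sum>z | z \<in> ?AB \<and> e - z \<in> supp c. coeff (a * b) z * coeff c (e - z))"
      using AB supp_times by (intro coeff_times) auto
    also have "\<dots> = (\<Sum>z | z \<in> ?AB \<and> e - z \<in> supp c.
        \<Sum>x | x \<in> supp a \<and> z - x \<in> supp b. coeff a x * coeff b (z - x) * coeff c (e - z))"
      by (intro sum.cong refl) (simp add: coeff_times[of "supp a" "supp b"] sum_distrib_right)
    also have "\<dots> = (\<Sum>(z, x) \<in> (SIGMA z : {z. z \<in> ?AB \<and> e - z \<in> supp c}.
        {x. x \<in> supp a \<and> z - x \<in> supp b}). coeff a x * coeff b (z - x) * coeff c (e - z))"
      using fin1 finab by (subst sum.Sigma) auto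
    also have "\<dots> = (\<Sum>(x, y) \<in> (SIGMA x : {x. x \<in> supp a \<and> e - x \<in> ?BC}.
        {y. y \<in> supp b \<and> e - x - y \<in> supp c}). ?t x y)"
    proof (rule sum.reindex_bij_witness[of _ "\<lambda>(x, y). (x + y, x)" "\<lambda>(z, x). (x, z - x)"])
      fix p assume p: "p \<in> (SIGMA z : {z. z \<in> ?AB \<and> e - z \<in> supp c}.
        {x. x \<in> supp a \<and> z - x \<in> supp b})"
      obtain z x where zx: "p = (z, x)" by (cases p)
      from p zx have "x \<in> supp a" "z - x \<in> supp b" "e - z \<in> supp c" by auto
      moreover from this have "e - x \<in> ?BC"
        by (intro CollectI exI[of _ "z - x"] exI[of _ "e - z"]) simp
      ultimately show "(case p of (z, x) \<Rightarrow> (x, z - x)) \<in> (SIGMA x : {x. x \<in> supp a \<and> e - x \<in> ?BC}.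
        {y. y \<in> supp b \<and> e - x - y \<in> supp c})" using zx by simp
    next
      fix p assume p: "p \<in> (SIGMA x : {x. x \<in> supp a \<and> e - x \<in> ?BC}.
        {y. y \<in> supp b \<and> e - x - y \<in> supp c})"
      obtain x y where xy: "p = (x, y)" by (cases p)
      from p xy have "x \<in> supp a" "y \<in> supp b" "e - x - y \<in> supp c" by auto
      then show "(case p of (x, y) \<Rightarrow> (x + y, x)) \<in> (SIGMA z : {z. z \<in> ?AB \<and> e - z \<in> supp c}.
        {x. x \<in> supp a \<and> z - x \<in> supp b})" using xy by (auto simp: diff_diff_eq)
    qed (auto simp: algebra_simps)
    also have "\<dots> = (\<Sum>x | x \<in> supp a \<and> e - x \<in> ?BC. \<Sum>y | y \<in> supp b \<and> e - x - y \<in> supp c. ?t x y)"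
      using fin2 finbc by (subst sum.Sigma) auto
    also have "\<dots> = (\<Sum>x | x \<in> supp a \<and> e - x \<in> ?BC. coeff a x * coeff (b * c) (e - x))"
      by (intro sum.cong refl)
        (simp add: coeff_times[of "supp b" "supp c"] sum_distrib_left mult.assoc)
    also have "\<dots> = coeff (a * (b * c)) e"
      using BC supp_times by (intro coeff_times[symmetric]) auto
    finally show "coeff (a * b * c) e = coeff (a * (b * c)) e" .
  qed
qed

end

lemma coeff_sum: "coeff (\<Sum>n\<in>N. f n) e = (\<Sum>n\<in>N. coeff (f n) e)"
  by (induction N rule: infinite_finite_induct)
    (simp_all add: zero_gen_puiseux.rep_eq plus_gen_puiseux.rep_eq)

lift_definition monom :: "'k::zero \<Rightarrow> real \<Rightarrow> 'k gen_puiseux"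
  is "\<lambda>c d e. if e = d then c else 0"
  subgoal for c d by (rule wo_set_mono[OF wo_set_singleton[of d]]) auto
  done

lemma coeff_monom_times:
  fixes f :: "'k::comm_ring_1 gen_puiseux"
  shows "coeff (monom c d * f) e = c * coeff f (e - d)"
proof -
  have "supp (monom c d) \<subseteq> {d}" by (auto simp: supp_def monom.rep_eq)
  then have "coeff (monom c d * f) e
      = (\<Sum>x | x \<in> {d} \<and> e - x \<in> supp f. coeff (monom c d) x * coeff f (e - x))"
    by (intro coeff_times) auto
  also have "\<dots> = (\<Sum>x\<in>{d}. coeff (monom c d) x * coeff f (e - x))"
    by (rule sum.mono_neutral_left) (auto simp: supp_def)
  finally show ?thesis by (simp add: monom.rep_eq)
qed

lemma coeff_power_eq_0:
  fixes g :: "'k::comm_ring_1 gen_puiseux"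
  assumes "\<And>e. e \<in> supp g \<Longrightarrow> d \<le> e" and "e < real n * d"
  shows "coeff (g ^ n) e = 0"
proof -
  have "real n * d \<le> e" if "e \<in> supp (g ^ n)" for e
    using that
  proof (induction n arbitrary: e)
    case 0
    then show ?case by (auto simp: supp_def one_gen_puiseux.rep_eq split: if_splits)
  next
    case (Suc n)
    then obtain a b where "e = a + b" "a \<in> supp g" "b \<in> supp (g ^ n)"
      using supp_times[of g "g ^ n"] by auto
    then show ?case using Suc.IH[of b] assms(1)[of a] by (simp add: algebra_simps)
  qed
  then show ?thesis using assms(2) by (force simp: supp_def)
qed

text \<open>
  If the support of \<open>g\<close> is bounded below by \<open>d > 0\<close>, then only finitely many powers of \<open>g\<close>
  contribute to a given coefficient of the geometric series.
\<close>

lemma geometric_inverse: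
  fixes g :: "'k::comm_ring_1 gen_puiseux"
  assumes d: "d > 0" and g: "\<And>e. e \<in> supp g \<Longrightarrow> d \<le> e"
  shows "\<exists>h. (1 - g) * h = 1"
proof -
  define N where "N e = nat \<lceil>e / d\<rceil>" for e
  define c where "c e = (\<Sum>n\<le>N e. coeff (g ^ n) e)" for e
  have c: "c e = (\<Sum>n\<le>M. coeff (g ^ n) e)" if "N e \<le> M" for e M
    unfolding c_def
  proof (rule sum.mono_neutral_left)
    show "\<forall>n\<in>{..M} - {..N e}. coeff (g ^ n) e = 0"
    proof
      fix n assume "n \<in> {..M} - {..N e}"
      then have "N e < n" by simp
      then have "e / d < real n" unfolding N_def by linarith
      then have "e < real n * d" using d by (simp add: field_simps)
      then show "coeff (g ^ n) e = 0" using coeff_power_eq_0 g by blast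
    qed
  qed (use that in auto)
  have Nmono: "N e \<le> N e'" if "e \<le> e'" for e e'
    unfolding N_def using that d by (intro nat_mono ceiling_mono divide_right_mono) auto
  have "wo_set {e. c e \<noteq> 0}"
  proof (rule wo_set_local)
    fix s
    have "{x \<in> {e. c e \<noteq> 0}. x \<le> s} \<subseteq> (\<Union>n\<in>{..N s}. supp (g ^ n))"
    proof
      fix x assume x: "x \<in> {x \<in> {e. c e \<noteq> 0}. x \<le> s}"
      then have "(\<Sum>n\<le>N s. coeff (g ^ n) x) \<noteq> 0" using c[of x "N s"] Nmono[of x s] by simp
      then obtain n where "n \<le> N s" "coeff (g ^ n) x \<noteq> 0"
        by (auto elim: sum.not_neutral_contains_not_neutral)
      then show "x \<in> (\<Union>n\<in>{..N s}. supp (g ^ n))" by (auto simp: supp_def)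
    qed
    moreover have "wo_set (\<Union>n\<in>{..N s}. supp (g ^ n))" by (rule wo_set_UN) auto
    ultimately show "wo_set {x \<in> {e. c e \<noteq> 0}. x \<le> s}" using wo_set_mono by blast
  qed
  then have h: "coeff (Abs_gen_puiseux c) = c" by (simp add: Abs_gen_puiseux_inverse)
  have "(1 - g) * Abs_gen_puiseux c = 1"
  proof (rule gen_puiseux_eqI)
    fix e
    define P where "P = (\<Sum>n\<le>N e. g ^ n)"
    have cP: "c x = coeff P x" if "x \<le> e" for x
      using c[of x "N e"] Nmono[OF that] by (simp add: P_def coeff_sum)
    have pos: "0 \<le> x" if "x \<in> supp (1 - g)" for x
    proof (rule ccontr)
      assume "\<not> 0 \<le> x"
      then have "coeff (1 - g) x = 0"
        using g[of x] d by (auto simp: minus_gen_puiseux.rep_eq one_gen_puiseux.rep_eq supp_def)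
      then show False using that by (simp add: supp_def)
    qed
    let ?B = "supp P \<union> supp (Abs_gen_puiseux c)"
    have B: "wo_set ?B" by (simp add: wo_set_Un)
    have "coeff ((1 - g) * Abs_gen_puiseux c) e
        = (\<Sum>x | x \<in> supp (1 - g) \<and> e - x \<in> ?B. coeff (1 - g) x * c (e - x))"
      using coeff_times[of "supp (1 - g)" ?B "1 - g" "Abs_gen_puiseux c" e] B h by simp
    also have "\<dots> = (\<Sum>x | x \<in> supp (1 - g) \<and> e - x \<in> ?B. coeff (1 - g) x * coeff P (e - x))"
      by (rule sum.cong) (auto simp: cP dest: pos)
    also have "\<dots> = coeff ((1 - g) * P) e"
      using coeff_times[of "supp (1 - g)" ?B "1 - g" P e] B by simp
    also have "(1 - g) * P = 1 - g ^ Suc (N e)"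
      using one_diff_power_eq[of g "Suc (N e)"] by (simp add: P_def lessThan_Suc_atMost)
    also have "coeff (g ^ Suc (N e)) e = 0"
    proof (rule coeff_power_eq_0[OF g])
      have "e / d < real (Suc (N e))" unfolding N_def by linarith
      then show "e < real (Suc (N e)) * d" using d by (simp add: field_simps)
    qed
    then have "coeff (1 - g ^ Suc (N e)) e = coeff 1 e"
      by (simp only: minus_gen_puiseux.rep_eq) simp
    finally show "coeff ((1 - g) * Abs_gen_puiseux c) e = coeff 1 e" .
  qed
  then show ?thesis by blast
qed

lemma gen_puiseux_inverse_exists:
  fixes f :: "'k::field gen_puiseux"
  assumes "f \<noteq> 0"
  shows "\<exists>h. f * h = 1"
proof -
  have "supp f \<noteq> {}" using assms gen_puiseux_eqI[of f 0]
    by (auto simp: supp_def zero_gen_puiseux.rep_eq)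
  then obtain m where m: "m \<in> supp f" "\<And>x. x \<in> supp f \<Longrightarrow> m \<le> x"
    using wo_setD[OF wo_set_supp order_refl] by blast
  define u where "u = monom (1 / coeff f m) (- m)"
  define g where "g = 1 - u * f"
  have cg: "coeff g e = (if e = 0 then 1 else 0) - coeff f (e + m) / coeff f m" for e
    by (simp add: g_def u_def minus_gen_puiseux.rep_eq one_gen_puiseux.rep_eq coeff_monom_times)
  have gpos: "e > 0" if "e \<in> supp g" for e
  proof -
    have "e \<noteq> 0" using that m(1) by (auto simp: supp_def cg)
    then have "e + m \<in> supp f" using that by (auto simp: supp_def cg)
    then have "m \<le> e + m" by (rule m(2))
    then show ?thesis using \<open>e \<noteq> 0\<close> by simp
  qed
  have "\<exists>d>0. \<forall>e\<in>supp g. d \<le> e"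
  proof (cases "supp g = {}")
    case True
    then show ?thesis by (auto intro: exI[of _ 1])
  next
    case False
    then obtain d where "d \<in> supp g" "\<And>x. x \<in> supp g \<Longrightarrow> d \<le> x"
      using wo_setD[OF wo_set_supp order_refl] by blast
    then show ?thesis using gpos by blast
  qed
  then obtain h where "(1 - g) * h = 1" using geometric_inverse by blast
  then have "f * (u * h) = 1" by (simp add: g_def mult.left_commute mult.assoc)
  then show ?thesis by blast
qed

instantiation gen_puiseux :: (field) inverse
begin

definition inverse_gen_puiseux :: "'a gen_puiseux \<Rightarrow> 'a gen_puiseux"
  where "inverse (f :: 'a gen_puiseux) = (if f = 0 then 0 else (THE h. f * h = 1))"

definition divide_gen_puiseux :: "'a gen_puiseux \<Rightarrow> 'a gen_puiseux \<Rightarrow> 'a gen_puiseux"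
  where "(f :: 'a gen_puiseux) div g = f * inverse g"

instance ..

end

instance gen_puiseux :: (field) field
proof
  fix a b :: "'a gen_puiseux"
  show "a div b = a * inverse b" by (simp add: divide_gen_puiseux_def)
  show "inverse (0 :: 'a gen_puiseux) = 0" by (simp add: inverse_gen_puiseux_def)
  assume "a \<noteq> 0"
  then obtain h where h: "a * h = 1" using gen_puiseux_inverse_exists by blast
  have "(THE h. a * h = 1) = h"
  proof (rule the_equality, rule h)
    fix h' assume "a * h' = 1"
    then show "h' = h" using h by (metis mult.assoc mult.commute mult_1)
  qed
  then show "inverse a * a = 1"
    using h \<open>a \<noteq> 0\<close> by (simp add: inverse_gen_puiseux_def mult.commute)
qed

section \<open>Tropical and supertropical elements\<close>

datatype tropical = TFin real | TInf

datatype supertropical = Tangible real | Ghost real | SInf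

fun tangible :: "tropical \<Rightarrow> supertropical"
  where
    "tangible (TFin a) = Tangible a"
  | "tangible TInf = SInf"

fun smag :: "supertropical \<Rightarrow> real"
  where
    "smag (Tangible a) = a"
  | "smag (Ghost a) = a"
  | "smag SInf = undefined"

definition sadd :: "supertropical \<Rightarrow> supertropical \<Rightarrow> supertropical"  (infixl \<open>\<oplus>\<^sub>s\<close> 65)
  where "s \<oplus>\<^sub>s s' =
    (if s = SInf then s'
     else if s' = SInf then s
     else if smag s < smag s' then s
     else if smag s' < smag s then s'
     else Ghost (smag s))"

definition smodels :: "supertropical \<Rightarrow> tropical \<Rightarrow> bool"  (infix \<open>\<Turnstile>\<^sub>s\<close> 50)
  where "c \<Turnstile>\<^sub>s d \<longleftrightarrow> c = tangible d \<or> (\<exists>g. c = tangible d \<oplus>\<^sub>s Ghost g)"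

lemma smodels_iff:
  "Tangible a \<Turnstile>\<^sub>s d \<longleftrightarrow> d = TFin a"
  "Ghost a \<Turnstile>\<^sub>s d \<longleftrightarrow> d = TInf \<or> (\<exists>b\<ge>a. d = TFin b)"
  "SInf \<Turnstile>\<^sub>s d \<longleftrightarrow> d = TInf"
  by (cases d; force simp: smodels_def sadd_def)+

definition deg :: "'k::zero gen_puiseux \<Rightarrow> tropical"
  where "deg a = (if a = 0 then TInf else TFin (LEAST e. e \<in> supp a))"

section \<open>Matrices with explicit index sets, rank and Kapranov rank\<close>

global_interpretation fun_space: vector_space "\<lambda>(c::'k::field) (v::'q \<Rightarrow> 'k) q. c * v q"
  defines fun_dim = fun_space.dim
  by standard (auto simp: fun_eq_iff algebra_simps)

text \<open>
  A matrix with rows \<open>P\<close> and columns \<open>Q\<close> is a function of which only the values on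
  \<open>P \<times> Q\<close> matter; its row vectors are padded with \<open>0\<close> outside \<open>Q\<close>.
\<close>

definition mat_rank :: "'p set \<Rightarrow> 'q set \<Rightarrow> ('p \<Rightarrow> 'q \<Rightarrow> 'k::field) \<Rightarrow> nat"
  where "mat_rank P Q L = fun_dim ((\<lambda>p q. if q \<in> Q then L p q else 0) ` P)"

definition kapranov_rank ::
  "'k::field itself \<Rightarrow> 'p set \<Rightarrow> 'q set \<Rightarrow> ('p \<Rightarrow> 'q \<Rightarrow> supertropical) \<Rightarrow> nat"
  where "kapranov_rank F P Q A =
    (LEAST r. \<exists>L :: 'p \<Rightarrow> 'q \<Rightarrow> 'k gen_puiseux.
       (\<forall>p\<in>P. \<forall>q\<in>Q. A p q \<Turnstile>\<^sub>s deg (L p q)) \<and> mat_rank P Q L = r)"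

section \<open>Symmetrized matrices\<close>

text \<open>
  The copies \<open>i\<^sup>1\<close>, \<open>i\<^sup>2\<close> of an index \<open>i\<close> are \<open>Inl i\<close>, \<open>Inr i\<close>, so that the row
  index set \<open>I\<^sup>1 \<union> I\<^sup>2\<close> is \<open>I <+> I\<close>.
\<close>

definition symmetrized :: "'a set \<Rightarrow> ('a + 'a \<Rightarrow> 'a \<Rightarrow> tropical) \<Rightarrow> bool"
  where "symmetrized I T \<longleftrightarrow>
    (\<forall>i\<in>I. T (Inl i) i = TFin 0 \<and> T (Inr i) i = TFin 0 \<and>
      (\<forall>i'\<in>I - {i}. T (Inl i) i' = TInf \<and> T (Inr i) i' = TInf))"

definition sym_sum :: "('a + 'a \<Rightarrow> 'a \<Rightarrow> tropical) \<Rightarrow> 'a \<Rightarrow> 'a \<Rightarrow> supertropical"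
  where "sym_sum T i j = tangible (T (Inl i) j) \<oplus>\<^sub>s tangible (T (Inr i) j)"

end

theory Submission
  imports Defs
begin

text \<open>
  Scale the rows \<open>i\<^sup>1\<close>, \<open>i\<^sup>2\<close> of a lift of \<open>T\<close> so that their entries in column \<open>i\<close> are \<open>1\<close>; this
  changes neither the degrees nor the rank. Subtracting row \<open>i\<^sup>2\<close> from row \<open>i\<^sup>1\<close> leaves a row
  supported on \<open>J\<close>, and these differences form a lift of \<open>\<Sigma>(T)\<close> of rank smaller by \<open>|I|\<close>.
  Conversely every lift of \<open>\<Sigma>(T)\<close> arises in this way, entry by entry; only when the two degrees
  agree is there something to choose, namely a nonzero leading coefficient that does not cancel
  against a prescribed one, and a field with three elements has room for that.
\<close>

section \<open>Degrees\<close>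

text \<open>Well-ordering of the support makes the \<open>LEAST\<close> in \<open>deg\<close> an
  attained minimum. Later degree computations use this coefficientwise form.\<close>

lemma deg_eq_TFin_iff:
  "deg m = TFin a \<longleftrightarrow> coeff m a \<noteq> 0 \<and> (\<forall>e<a. coeff m e = 0)"
proof
  assume l: "deg m = TFin a"
  then have "m \<noteq> 0" and a: "a = (LEAST e. e \<in> supp m)"
    by (auto simp: deg_def split: if_splits)
  then have "supp m \<noteq> {}" using gen_puiseux_eqI[of m 0]
    by (auto simp: supp_def zero_gen_puiseux.rep_eq)
  then obtain b where b: "b \<in> supp m" "\<And>x. x \<in> supp m \<Longrightarrow> b \<le> x"
    using wo_setD[OF wo_set_supp order_refl] by blast
  then have "a = b" unfolding a by (intro Least_equality)
  then show "coeff m a \<noteq> 0 \<and> (\<forall>e<a. coeff m e = 0)"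
    using b by (force simp: supp_def)
next
  assume r: "coeff m a \<noteq> 0 \<and> (\<forall>e<a. coeff m e = 0)"
  then have "m \<noteq> 0" by (auto simp: zero_gen_puiseux.rep_eq)
  moreover have "(LEAST e. e \<in> supp m) = a"
    using r by (intro Least_equality) (auto simp: supp_def intro: leI)
  ultimately show "deg m = TFin a" by (simp add: deg_def)
qed

lemma deg_eq_TInf_iff [simp]: "deg m = TInf \<longleftrightarrow> m = 0"
  by (simp add: deg_def)

lemma deg_zero [simp]: "deg 0 = TInf"
  by simp

lemma deg_monom: "c \<noteq> 0 \<Longrightarrow> deg (monom c d) = TFin d"
  by (simp add: deg_eq_TFin_iff monom.rep_eq)

lemma deg_one: "deg (1 :: 'k::comm_ring_1 gen_puiseux) = TFin 0"
  by (simp add: deg_eq_TFin_iff one_gen_puiseux.rep_eq)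

text \<open>In the convolution at \<open>a + b\<close> only the index \<open>x = a\<close> survives,
  leaving the product of the two leading coefficients, which is nonzero over a field. Below
  \<open>a + b\<close> no index survives.\<close>

lemma deg_times:
  fixes f g :: "'k::field gen_puiseux"
  assumes "deg f = TFin a" "deg g = TFin b"
  shows "deg (f * g) = TFin (a + b)"
proof -
  note fg = assms[unfolded deg_eq_TFin_iff]
  have below: "a \<le> x" "b \<le> e - x" if "coeff f x \<noteq> 0" "coeff g (e - x) \<noteq> 0" for e x
    using fg that by (metis not_le)+
  have "{x. coeff f x \<noteq> 0 \<and> coeff g (a + b - x) \<noteq> 0} = {a}"
    using fg below[of _ "a + b"] by force
  then have "coeff (f * g) (a + b) \<noteq> 0"
    using fg by (simp add: times_gen_puiseux.rep_eq)
  moreover have "coeff (f * g) e = 0" if "e < a + b" for e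
  proof -
    have "{x. coeff f x \<noteq> 0 \<and> coeff g (e - x) \<noteq> 0} = {}"
      using below[of _ e] that by force
    then show ?thesis by (simp only: times_gen_puiseux.rep_eq sum.empty)
  qed
  ultimately show ?thesis by (simp add: deg_eq_TFin_iff)
qed

lemma deg_divide_unit:
  fixes f u :: "'k::field gen_puiseux"
  assumes u: "deg u = TFin 0"
  shows "deg (f / u) = deg f"
proof (cases "f = 0")
  case False
  have "u \<noteq> 0" using u by (auto simp: deg_def)
  with False have "f / u \<noteq> 0" by simp
  then obtain d where d: "deg (f / u) = TFin d" by (cases "deg (f / u)") auto
  from deg_times[OF d u] d \<open>u \<noteq> 0\<close> show ?thesis by simp
qed simp

text \<open>In the ghost case, vanishing of the coefficients below \<open>a\<close> covers both a
  finite degree of at least \<open>a\<close> and \<open>m = 0\<close>.\<close>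

lemma smodels_deg_iff:
  "Tangible a \<Turnstile>\<^sub>s deg m \<longleftrightarrow> deg m = TFin a"
  "Ghost a \<Turnstile>\<^sub>s deg m \<longleftrightarrow> (\<forall>e<a. coeff m e = 0)"
  "SInf \<Turnstile>\<^sub>s deg m \<longleftrightarrow> m = 0"
proof -
  show "Ghost a \<Turnstile>\<^sub>s deg m \<longleftrightarrow> (\<forall>e<a. coeff m e = 0)"
  proof (cases "deg m")
    case (TFin b)
    then show ?thesis
      by (auto simp: smodels_iff(2) dest: deg_eq_TFin_iff[THEN iffD1] intro: leI)
  next
    case TInf
    then show ?thesis by (simp add: smodels_iff(2) zero_gen_puiseux.rep_eq)
  qed
qed (simp_all add: smodels_iff)

lemma tangible_smodels_deg_iff: "tangible t \<Turnstile>\<^sub>s deg m \<longleftrightarrow> deg m = t"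
  by (cases t) (simp_all add: smodels_deg_iff)

text \<open>If the degrees differ, the leading term of smaller degree survives subtraction. If they
  are equal and finite, the leading terms may cancel, but nothing appears below them, which is all
  that a ghost sum demands.\<close>

lemma sadd_tangible_smodels_deg_diff:
  fixes x y :: "'k::field gen_puiseux"
  shows "tangible (deg x) \<oplus>\<^sub>s tangible (deg y) \<Turnstile>\<^sub>s deg (x - y)"
proof (cases "deg x"; cases "deg y")
  fix a b assume d: "deg x = TFin a" "deg y = TFin b"
  show ?thesis
    unfolding d using d[unfolded deg_eq_TFin_iff]
    by (auto simp: sadd_def smodels_deg_iff deg_eq_TFin_iff minus_gen_puiseux.rep_eq)
next
  fix b assume d: "deg x = TInf" "deg y = TFin b"
  show ?thesis
    unfolding d using d[unfolded deg_eq_TFin_iff deg_eq_TInf_iff]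
    by (auto simp: sadd_def smodels_deg_iff deg_eq_TFin_iff uminus_gen_puiseux.rep_eq)
qed (auto simp: sadd_def smodels_iff)

text \<open>This is the converse of the previous lemma. If the finite degrees differ, the series of
  larger degree can be a monomial, since adding it to \<open>m\<close> or subtracting
  \<open>m\<close> from it leaves the leading degree of \<open>m\<close> in place.\<close>

lemma diff_lift_exists:
  fixes m :: "'k::field gen_puiseux"
  assumes card: "infinite (UNIV :: 'k set) \<or> card (UNIV :: 'k set) \<ge> 3"
    and m: "tangible s \<oplus>\<^sub>s tangible t \<Turnstile>\<^sub>s deg m"
  shows "\<exists>x y. deg x = s \<and> deg y = t \<and> x - y = m"
proof (cases s; cases t)
  fix a b assume st: "s = TFin a" "t = TFin b"
  consider "a < b" | "b < a" | "a = b" by linarith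
  then show ?thesis
  proof cases
    case 1
    let ?y = "monom (1::'k) b"
    have "deg (m + ?y) = TFin a"
      using m st 1 by (auto simp: sadd_def smodels_deg_iff deg_eq_TFin_iff
          plus_gen_puiseux.rep_eq monom.rep_eq)
    then show ?thesis using st
      by (intro exI[of _ "m + ?y"] exI[of _ ?y]) (simp add: deg_monom)
  next
    case 2
    let ?x = "monom (1::'k) a"
    have "deg (?x - m) = TFin b"
      using m st 2 by (auto simp: sadd_def smodels_deg_iff deg_eq_TFin_iff
          minus_gen_puiseux.rep_eq monom.rep_eq)
    then show ?thesis using st
      by (intro exI[of _ ?x] exI[of _ "?x - m"]) (simp add: deg_monom)
  next
    case 3
    \<comment> \<open>With \<open>y = monom c a\<close> and \<open>x = m + y\<close>, the
      coefficients at \<open>a\<close> are \<open>c\<close> and \<open>coeff m a + c\<close>. Both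
      must be nonzero, so at most two values of \<open>c\<close> are excluded.\<close>
    have "\<not> UNIV \<subseteq> {0, - coeff m a}"
    proof
      assume sub: "UNIV \<subseteq> {0, - coeff m a}"
      then have "finite (UNIV :: 'k set)" using finite_subset by blast
      moreover have "card (UNIV :: 'k set) \<le> card {0, - coeff m a}"
        using sub by (intro card_mono) auto
      moreover have "card {0, - coeff m a} \<le> 2" by (simp add: card_insert_if)
      ultimately show False using card by linarith
    qed
    then obtain c where c: "c \<noteq> 0" "c \<noteq> - coeff m a" by blast
    then have "coeff m a + c \<noteq> 0" by (metis add.commute eq_neg_iff_add_eq_0)
    then have "deg (m + monom c a) = TFin a"
      using m st 3 by (auto simp: sadd_def smodels_deg_iff deg_eq_TFin_iff
          plus_gen_puiseux.rep_eq monom.rep_eq)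
    then show ?thesis using st 3 c
      by (intro exI[of _ "m + monom c a"] exI[of _ "monom c a"]) (simp add: deg_monom)
  qed
next
  fix a assume "s = TFin a" "t = TInf"
  then show ?thesis using m
    by (intro exI[of _ m] exI[of _ 0]) (auto simp: sadd_def smodels_deg_iff)
next
  fix b assume "s = TInf" "t = TFin b"
  then show ?thesis using m
    by (intro exI[of _ 0] exI[of _ "- m"])
      (auto simp: sadd_def smodels_deg_iff deg_eq_TFin_iff uminus_gen_puiseux.rep_eq)
next
  assume "s = TInf" "t = TInf"
  then show ?thesis using m
    by (intro exI[of _ 0] exI[of _ 0]) (auto simp: sadd_def smodels_deg_iff)
qed

section \<open>Kapranov rank\<close>

lemma smodels_deg_exists: "\<exists>m :: 'k::field gen_puiseux. c \<Turnstile>\<^sub>s deg m"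
proof (cases c)
  case (Tangible a)
  then show ?thesis
    by (intro exI[of _ "monom 1 a"]) (simp add: smodels_iff deg_monom)
qed (auto intro!: exI[of _ 0] simp: smodels_deg_iff zero_gen_puiseux.rep_eq)

text \<open>Choosing a series for each entry independently gives some lift, so the
  \<open>LEAST\<close> defining the rank is taken over a nonempty set.\<close>

lemma kapranov_rank_attained:
  "\<exists>L :: 'p \<Rightarrow> 'q \<Rightarrow> 'k::field gen_puiseux.
    (\<forall>p\<in>P. \<forall>q\<in>Q. A p q \<Turnstile>\<^sub>s deg (L p q)) \<and> mat_rank P Q L = kapranov_rank TYPE('k) P Q A"
proof -
  define L :: "'p \<Rightarrow> 'q \<Rightarrow> 'k gen_puiseux" where "L p q = (SOME m. A p q \<Turnstile>\<^sub>s deg m)" for p q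
  have "A p q \<Turnstile>\<^sub>s deg (L p q)" for p q
    unfolding L_def by (rule someI_ex[OF smodels_deg_exists])
  then have "\<exists>L' :: 'p \<Rightarrow> 'q \<Rightarrow> 'k gen_puiseux.
    (\<forall>p\<in>P. \<forall>q\<in>Q. A p q \<Turnstile>\<^sub>s deg (L' p q)) \<and> mat_rank P Q L' = mat_rank P Q L"
    by (intro exI[of _ L]) simp
  then show ?thesis
    unfolding kapranov_rank_def by (rule LeastI)
qed

lemma kapranov_rank_le:
  fixes L :: "'p \<Rightarrow> 'q \<Rightarrow> 'k::field gen_puiseux"
  assumes "\<And>p q. p \<in> P \<Longrightarrow> q \<in> Q \<Longrightarrow> A p q \<Turnstile>\<^sub>s deg (L p q)"
  shows "kapranov_rank TYPE('k) P Q A \<le> mat_rank P Q L"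
  unfolding kapranov_rank_def using assms by (intro Least_le) blast

section \<open>Rank of a symmetrized lift\<close>

text \<open>Evaluation at a new index \<open>i\<close> is a linear functional that kills the vectors
  already collected but not \<open>u i\<close>, so \<open>u i\<close> lies outside their
  span.\<close>

lemma independent_Un_dual_family:
  fixes u :: "'q \<Rightarrow> 'q \<Rightarrow> 'k::field"
  assumes "finite I" and u: "\<And>i i'. i \<in> I \<Longrightarrow> i' \<in> I \<Longrightarrow> u i i' = (if i = i' then 1 else 0)"
    and B: "fun_space.independent B" "finite B" "\<And>v i. v \<in> B \<Longrightarrow> i \<in> I \<Longrightarrow> v i = 0"
  shows "fun_space.independent (u ` I \<union> B) \<and> card (u ` I \<union> B) = card I + card B"
  using \<open>finite I\<close> u B(3)
proof (induction I rule: finite_induct)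
  case empty
  then show ?case using B by simp
next
  case (insert i I)
  let ?S = "u ` I \<union> B"
  have IH: "fun_space.independent ?S" "card ?S = card I + card B"
    using insert.IH insert.prems by auto
  have "fun_space.span ?S \<subseteq> {v. v i = 0}"
  proof (rule fun_space.span_minimal)
    show "?S \<subseteq> {v. v i = 0}" using insert.prems insert.hyps by auto
    show "fun_space.subspace {v. v i = (0::'k)}" by (auto simp: fun_space.subspace_def)
  qed
  moreover have "u i i = 1" using insert.prems by simp
  ultimately have ni: "u i \<notin> fun_space.span ?S" by auto
  then have "u i \<notin> ?S" using fun_space.span_base[of "u i" ?S] by argo
  then show ?case
    using fun_space.independent_insertI[OF ni IH(1)] IH(2) insert.hyps B(2) by simp
qed

text \<open>The rows have the same span as the normalized first-copy rows \<open>u i\<close>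
  together with the differences \<open>w i\<close>. On the columns in \<open>I\<close> the former
  are unit vectors and the latter vanish, so the two dimensions add.\<close>

lemma mat_rank_symmetrized:
  fixes L :: "'a + 'a \<Rightarrow> 'a \<Rightarrow> 'k::field"
  assumes fin: "finite I" and disj: "I \<inter> J = {}"
    and diag: "\<And>i. i \<in> I \<Longrightarrow> L (Inl i) i \<noteq> 0" "\<And>i. i \<in> I \<Longrightarrow> L (Inr i) i \<noteq> 0"
    and off: "\<And>i i'. i \<in> I \<Longrightarrow> i' \<in> I \<Longrightarrow> i' \<noteq> i \<Longrightarrow> L (Inl i) i' = 0"
      "\<And>i i'. i \<in> I \<Longrightarrow> i' \<in> I \<Longrightarrow> i' \<noteq> i \<Longrightarrow> L (Inr i) i' = 0"
  shows "mat_rank (I <+> I) (I \<union> J) L =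
    mat_rank I J (\<lambda>i j. L (Inl i) j / L (Inl i) i - L (Inr i) j / L (Inr i) i) + card I"
proof -
  define R where "R p q = (if q \<in> I \<union> J then L p q else 0)" for p q
  define u where "u i q = R (Inl i) q / L (Inl i) i" for i q
  define w where "w i q =
    (if q \<in> J then L (Inl i) q / L (Inl i) i - L (Inr i) q / L (Inr i) i else 0)" for i q
  have u_dual: "u i i' = (if i = i' then 1 else 0)" if "i \<in> I" "i' \<in> I" for i i'
    using that diag off by (auto simp: u_def R_def)
  have w0: "w i i' = 0" if "i' \<in> I" for i i'
    using that disj by (auto simp: w_def)
  have Rl: "R (Inl i) = (\<lambda>q. L (Inl i) i * u i q)" if "i \<in> I" for i
    using diag that by (auto simp: u_def)
  \<comment> \<open>Both normalized rows restrict to the same unit vector on \<open>I\<close>, so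
    their difference lives on \<open>J\<close> alone.\<close>
  have w_eq: "w i = u i - (\<lambda>q. inverse (L (Inr i) i) * R (Inr i) q)" if "i \<in> I" for i
  proof
    fix q
    show "w i q = (u i - (\<lambda>q. inverse (L (Inr i) i) * R (Inr i) q)) q"
      using that diag[of i] disj off[of i q]
      by (cases "q = i") (auto simp: w_def u_def R_def divide_inverse)
  qed
  have u_eq: "u i = (\<lambda>q. inverse (L (Inl i) i) * R (Inl i) q)" for i
    by (auto simp: u_def divide_inverse)
  have Rr: "R (Inr i) = (\<lambda>q. L (Inr i) i * (u i - w i) q)" if "i \<in> I" for i
    using diag that w_eq[OF that] by (auto simp: fun_eq_iff)
  \<comment> \<open>The differences may be dependent or coincide. A basis chosen among them still
    vanishes on \<open>I\<close>.\<close>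
  obtain B where B: "B \<subseteq> w ` I" "fun_space.independent B" "w ` I \<subseteq> fun_space.span B"
    "card B = fun_dim (w ` I)"
    using fun_space.basis_exists by blast
  have finB: "finite B" using B(1) fin finite_subset by blast
  have ind: "fun_space.independent (u ` I \<union> B)" "card (u ` I \<union> B) = card I + card B"
    using independent_Un_dual_family[OF fin u_dual B(2) finB] B(1) w0 by blast+
  let ?U = "fun_space.span (u ` I \<union> B)" and ?R = "fun_space.span (R ` (I <+> I))"
  have u_in: "u i \<in> ?U" if "i \<in> I" for i
    using that by (auto intro: fun_space.span_base)
  have w_in: "w i \<in> ?U" if "i \<in> I" for i
    using that B(3) fun_space.span_mono[of B "u ` I \<union> B"] by blast
  have u_R: "u i \<in> ?R" if "i \<in> I" for i
    unfolding u_eq[of i] using that by (intro fun_space.span_scale fun_space.span_base) auto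
  have w_R: "w i \<in> ?R" if "i \<in> I" for i
    unfolding w_eq[OF that] using that
    by (intro fun_space.span_diff u_R fun_space.span_scale fun_space.span_base) auto
  have "?U = ?R"
  proof (rule subset_antisym)
    show "?U \<subseteq> ?R"
      using u_R w_R B(1) by (intro fun_space.span_minimal) auto
    have "R (Inl i) \<in> ?U" if "i \<in> I" for i
      unfolding Rl[OF that] by (intro fun_space.span_scale u_in that)
    moreover have "R (Inr i) \<in> ?U" if "i \<in> I" for i
      unfolding Rr[OF that] by (intro fun_space.span_scale fun_space.span_diff u_in w_in that)
    ultimately show "?R \<subseteq> ?U"
      by (intro fun_space.span_minimal) auto
  qed
  then have "fun_dim (R ` (I <+> I)) = card (u ` I \<union> B)"
    using ind(1) by (rule fun_space.dim_eq_card)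
  then show ?thesis using ind(2) B(4)
    by (simp add: mat_rank_def R_def[abs_def] w_def[abs_def])
qed

theorem theorem3:
  fixes I J :: "'a set" and T :: "'a + 'a \<Rightarrow> 'a \<Rightarrow> tropical"
  assumes "infinite (UNIV :: 'k::field set) \<or> card (UNIV :: 'k set) \<ge> 3"
    and "finite I" and "finite J" and "I \<inter> J = {}"
    and "symmetrized I T"
  shows "kapranov_rank TYPE('k) (I <+> I) (I \<union> J) (\<lambda>p q. tangible (T p q)) =
    kapranov_rank TYPE('k) I J (sym_sum T) + card I"
proof (rule antisym)
  have T: "T (Inl i) i = TFin 0" "T (Inr i) i = TFin 0"
    "\<And>i'. i' \<in> I \<Longrightarrow> i' \<noteq> i \<Longrightarrow> T (Inl i) i' = TInf"
    "\<And>i'. i' \<in> I \<Longrightarrow> i' \<noteq> i \<Longrightarrow> T (Inr i) i' = TInf" if "i \<in> I" for i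
    using assms(5) that by (auto simp: symmetrized_def)
  \<comment> \<open>The second inequality comes first: a lift of \<open>T\<close> of minimal rank is
    normalized, and its row differences lift \<open>sym_sum T\<close>.\<close>
  {
    obtain L :: "'a + 'a \<Rightarrow> 'a \<Rightarrow> 'k gen_puiseux" where
      lift: "\<And>p q. p \<in> I <+> I \<Longrightarrow> q \<in> I \<union> J \<Longrightarrow> tangible (T p q) \<Turnstile>\<^sub>s deg (L p q)"
      and rank: "mat_rank (I <+> I) (I \<union> J) L =
        kapranov_rank TYPE('k) (I <+> I) (I \<union> J) (\<lambda>p q. tangible (T p q))"
      using kapranov_rank_attained[of "I <+> I" "I \<union> J" "\<lambda>p q. tangible (T p q)"] by blast
    have deg: "deg (L (Inl i) q) = T (Inl i) q" "deg (L (Inr i) q) = T (Inr i) q"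
      if "i \<in> I" "q \<in> I \<union> J" for i q
      using lift that by (auto simp: tangible_smodels_deg_iff)
    have diag: "deg (L (Inl i) i) = TFin 0" "deg (L (Inr i) i) = TFin 0" if "i \<in> I" for i
      using that deg T by auto
    let ?M = "\<lambda>i j. L (Inl i) j / L (Inl i) i - L (Inr i) j / L (Inr i) i"
    have "mat_rank (I <+> I) (I \<union> J) L = mat_rank I J ?M + card I"
    proof (rule mat_rank_symmetrized[OF assms(2,4)])
      show "L (Inl i) i \<noteq> 0" "L (Inr i) i \<noteq> 0" if "i \<in> I" for i
        using diag[OF that] by (auto simp: deg_def)
      show "L (Inl i) i' = 0" "L (Inr i) i' = 0" if "i \<in> I" "i' \<in> I" "i' \<noteq> i" for i i'
        using that deg[of i i'] T by auto
    qed
    moreover have "kapranov_rank TYPE('k) I J (sym_sum T) \<le> mat_rank I J ?M"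
    proof (rule kapranov_rank_le)
      fix i j assume "i \<in> I" "j \<in> J"
      then show "sym_sum T i j \<Turnstile>\<^sub>s deg (?M i j)"
        using sadd_tangible_smodels_deg_diff[of "L (Inl i) j / L (Inl i) i" "L (Inr i) j / L (Inr i) i"]
        by (simp add: sym_sum_def deg_divide_unit diag deg)
    qed
    ultimately show "kapranov_rank TYPE('k) I J (sym_sum T) + card I
      \<le> kapranov_rank TYPE('k) (I <+> I) (I \<union> J) (\<lambda>p q. tangible (T p q))"
      using rank by simp
  }
  \<comment> \<open>For the other inequality, a minimal lift of \<open>sym_sum T\<close> is split
    entry by entry into differences.\<close>
  obtain M :: "'a \<Rightarrow> 'a \<Rightarrow> 'k gen_puiseux" where
    lift: "\<And>i j. i \<in> I \<Longrightarrow> j \<in> J \<Longrightarrow> sym_sum T i j \<Turnstile>\<^sub>s deg (M i j)"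
    and rank: "mat_rank I J M = kapranov_rank TYPE('k) I J (sym_sum T)"
    using kapranov_rank_attained[of I J "sym_sum T"] by blast
  have "\<exists>x y. deg x = T (Inl i) j \<and> deg y = T (Inr i) j \<and> x - y = M i j"
    if "i \<in> I" "j \<in> J" for i j
    using diff_lift_exists[OF assms(1)] lift[OF that] by (simp add: sym_sum_def)
  then obtain X Y where XY: "\<And>i j. i \<in> I \<Longrightarrow> j \<in> J \<Longrightarrow>
      deg (X i j) = T (Inl i) j \<and> deg (Y i j) = T (Inr i) j \<and> X i j - Y i j = M i j"
    by metis
  \<comment> \<open>Both copies carry an identity block on the columns in \<open>I\<close>. This
    meets the degrees prescribed by \<open>symmetrized\<close>, and the normalizing divisors are
    \<open>1\<close>.\<close>
  define L where "L p q = (case p of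
      Inl i \<Rightarrow> if q \<in> I then if q = i then 1 else 0 else X i q
    | Inr i \<Rightarrow> if q \<in> I then if q = i then 1 else 0 else Y i q)" for p q
  have notI: "j \<notin> I" if "j \<in> J" for j using that assms(4) by blast
  have "kapranov_rank TYPE('k) (I <+> I) (I \<union> J) (\<lambda>p q. tangible (T p q))
      \<le> mat_rank (I <+> I) (I \<union> J) L"
    by (rule kapranov_rank_le)
      (auto simp: tangible_smodels_deg_iff L_def T XY deg_one notI)
  also have "\<dots> = mat_rank I J
      (\<lambda>i j. L (Inl i) j / L (Inl i) i - L (Inr i) j / L (Inr i) i) + card I"
    by (rule mat_rank_symmetrized[OF assms(2,4)]) (auto simp: L_def)
  also have "mat_rank I J (\<lambda>i j. L (Inl i) j / L (Inl i) i - L (Inr i) j / L (Inr i) i)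
      = mat_rank I J M"
    \<comment> \<open>\<open>X i j - Y i j = M i j\<close> is known only for \<open>i\<close> in
      \<open>I\<close> and \<open>j\<close> in \<open>J\<close>; the zero padding in
      \<open>mat_rank\<close> hides all other columns.\<close>
    unfolding mat_rank_def
    by (intro arg_cong[where f = fun_dim] image_cong refl)
      (auto simp: fun_eq_iff L_def XY notI)
  finally show "kapranov_rank TYPE('k) (I <+> I) (I \<union> J) (\<lambda>p q. tangible (T p q))
      \<le> kapranov_rank TYPE('k) I J (sym_sum T) + card I"
    using rank by simp
qed

end
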